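(* Let $x_0,c\in\mathbb{R}$. The line $L_c(x_0):\ x=x_0+tf'(c)$, $t>0$, is a divide if and only if $$\int_{x_0}^{x_0+l}(\varphi(\xi)-c)\,d\xi\ge0\qquad\text{for any }l\in\mathbb{R}.$$
   Context: Setting: $f\in C^2(\mathbb{R})$, $f''\ge0$, $\mathcal{L}\{f''=0\}=0$ (Lebesgue measure), so $f'$ is strictly increasing; $\varphi\in L^\infty(\mathbb{R})$. For $t>0$: $E(u;x,t)=t\int_0^u f''(s)(\varphi(x-tf'(s))-s)\,ds$, and $\mathcal{U}(x,t)$ is the (nonempty compact) set of maximizers of $E(\cdot\,;x,t)$ over $\mathbb{R}$. $L_c(x_0)$ is called a divide (emitting from $x_0$ with speed $c$) if $\mathcal{U}(x,t)=\{c\}$ for every point $(x,t)\in L_c(x_0)$, $t>0$. *)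

theory Defs
  imports "HOL-Analysis.Analysis"
begin

definition C2 :: "(real \<Rightarrow> real) \<Rightarrow> bool" where
  "C2 f \<longleftrightarrow> f C1_differentiable_on UNIV \<and> deriv f C1_differentiable_on UNIV"

definition L_infinity :: "(real \<Rightarrow> real) \<Rightarrow> bool" where
  "L_infinity \<phi> \<longleftrightarrow>
     \<phi> \<in> borel_measurable lebesgue \<and> (\<exists>M. AE x in lebesgue. \<bar>\<phi> x\<bar> \<le> M)"

text \<open>
  Integrals are taken over \<^const>\<open>lebesgue\<close> rather than \<^const>\<open>lborel\<close>, since a representative
  of an essentially bounded function need not be Borel measurable. The interval integral is
  oriented: swapping its bounds changes the sign.
\<close>

definition E :: "(real \<Rightarrow> real) \<Rightarrow> (real \<Rightarrow> real) \<Rightarrow> real \<Rightarrow> real \<Rightarrow> real \<Rightarrow> real" where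
  "E f \<phi> u x t =
     t * (LINT s=ereal 0..ereal u|lebesgue. (deriv (deriv f) s * (\<phi> (x - t * deriv f s) - s)))"

definition maximizers :: "(real \<Rightarrow> real) \<Rightarrow> (real \<Rightarrow> real) \<Rightarrow> real \<Rightarrow> real \<Rightarrow> real set" where
  "maximizers f \<phi> x t = {u. \<forall>v. E f \<phi> v x t \<le> E f \<phi> u x t}"

definition ray :: "(real \<Rightarrow> real) \<Rightarrow> real \<Rightarrow> real \<Rightarrow> (real \<times> real) set" where
  "ray f c x\<^sub>0 = {(x, t). t > 0 \<and> x = x\<^sub>0 + t * deriv f c}"

definition divide_ray :: "(real \<Rightarrow> real) \<Rightarrow> (real \<Rightarrow> real) \<Rightarrow> real \<Rightarrow> real \<Rightarrow> bool" where
  "divide_ray f \<phi> c x\<^sub>0 \<longleftrightarrow> (\<forall>(x, t) \<in> ray f c x\<^sub>0. maximizers f \<phi> x t = {c})"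

end

theory Submission
  imports Defs
begin

text \<open>
  Put \<open>g = deriv f\<close> and let \<open>(x, t)\<close> be the point of the ray at time \<open>t\<close>. Substituting
  \<open>\<xi> = x - t * g s\<close> turns the difference of energies into
  \[ E(u) - E(c) = - \int_{x_0}^{x_0 + t (g(c) - g(u))} (\varphi - c) - t W(u), \qquad
     W(u) = \int_c^u g'(s) (s - c)\,ds = g(u) (u - c) - (f(u) - f(c)). \]
  By the mean value theorem \<open>0 < W u \<le> (u - c) * (g u - g c)\<close> for \<open>u \<noteq> c\<close>. Positivity gives the
  direction from the integral condition to the divide. Conversely, for fixed \<open>l\<close> choose the time
  \<open>t = l / (g c - g u)\<close>: the integral up to \<open>x\<^sub>0 + l\<close> is then at least
  \<open>- t * W u \<ge> - \<bar>u - c\<bar> * \<bar>l\<bar>\<close>, which tends to \<open>0\<close> as \<open>u \<rightarrow> c\<close>.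
\<close>

section \<open>Oriented integrals over the completed Lebesgue measure\<close>

lemma interval_integral_lebesgue_eq_integral:
  fixes F :: "real \<Rightarrow> real"
  assumes "F absolutely_integrable_on {a..b}" "a \<le> b"
  shows "(LINT x=ereal a..ereal b|lebesgue. F x) = integral {a..b} F"
proof -
  \<comment> \<open>Oriented integrals run over open intervals, so the endpoints are dropped here
    and restored as a null set at the end.\<close>
  have "F absolutely_integrable_on {a<..<b}"
    by (rule set_integrable_subset[OF assms(1)]) auto
  then have "(LINT x:{a<..<b}|lebesgue. F x) = integral {a<..<b} F"
    by (rule set_lebesgue_integral_eq_integral)
  then show ?thesis
    using assms(2) by (simp add: interval_lebesgue_integral_le_eq integral_open_interval_real)
qed

lemma interval_integral_lebesgue_reverse:
  fixes F :: "real \<Rightarrow> real"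
  shows "(LINT x=a..b|lebesgue. F x) = - (LINT x=b..a|lebesgue. F x)"
  by (cases a b rule: linorder_cases)
    (auto simp: interval_lebesgue_integral_def set_lebesgue_integral_def einterval_same)

text \<open>Removes the base point \<open>0\<close> of \<open>E\<close>: a difference of energies
  depends only on the integrand between \<open>c\<close> and \<open>u\<close>, wherever the base
  point lies.\<close>

lemma interval_integral_lebesgue_diff:
  fixes F :: "real \<Rightarrow> real"
  assumes F: "\<And>a b. F absolutely_integrable_on {a..b}" and "c \<le> u"
  shows "(LINT x=ereal a..ereal u|lebesgue. F x) - (LINT x=ereal a..ereal c|lebesgue. F x)
    = integral {c..u} F"
proof -
  have int: "F integrable_on {p..q}" for p q
    using F by (rule set_lebesgue_integral_eq_integral)
  have up: "(LINT x=ereal p..ereal q|lebesgue. F x) = integral {p..q} F" if "p \<le> q" for p q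
    using F that by (rule interval_integral_lebesgue_eq_integral)
  have down: "(LINT x=ereal p..ereal q|lebesgue. F x) = - integral {q..p} F" if "q \<le> p" for p q
    by (subst interval_integral_lebesgue_reverse) (simp add: up that)
  have comb: "integral {p..q} F + integral {q..r} F = integral {p..r} F" if "p \<le> q" "q \<le> r" for p q r
    using that int by (rule Henstock_Kurzweil_Integration.integral_combine)
  consider "a \<le> c" | "c \<le> a" "a \<le> u" | "u \<le> a" by linarith
  then show ?thesis
  proof cases
    case 1
    then show ?thesis using comb[of a c u] \<open>c \<le> u\<close> by (simp add: up)
  next
    case 2
    then show ?thesis using comb[of c a u] by (simp add: up down)
  next
    case 3
    then show ?thesis using comb[of c u a] \<open>c \<le> u\<close> by (simp add: down)
  qed
qed

lemma L_infinity_absolutely_integrable: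
  assumes "L_infinity \<phi>"
  shows "\<phi> absolutely_integrable_on {a..b}"
proof -
  obtain M where "\<phi> \<in> borel_measurable lebesgue" "AE x in lebesgue. \<bar>\<phi> x\<bar> \<le> M"
    using assms by (auto simp: L_infinity_def)
  then show ?thesis
    unfolding set_integrable_def
    by (intro integrableI_bounded_set_indicator[where B = M])
      (auto simp: emeasure_lborel_Icc_eq)
qed

section \<open>Change of variables and strict monotonicity of \<open>deriv f\<close>\<close>

text \<open>The map \<open>s\<close> to \<open>x - t * g s\<close> is injective because
  \<open>g\<close> is strictly increasing, so the change of variables with the absolute value of the
  derivative applies to a merely integrable \<open>F\<close>. The map is decreasing, hence the
  swapped endpoints; the sign disappears since \<open>t * h s\<close> is nonnegative.\<close>

lemma integral_substitution_antimono:
  fixes g h F :: "real \<Rightarrow> real"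
  assumes F: "\<And>a b. F absolutely_integrable_on {a..b}"
    and der: "\<And>s. (g has_real_derivative h s) (at s)"
    and h: "\<And>s. h s \<ge> 0" and g: "strict_mono g" and t: "t > 0" and ab: "a \<le> b"
  shows "(\<lambda>s. h s * F (x - t * g s)) absolutely_integrable_on {a..b}" (is ?int)
    and "t * integral {a..b} (\<lambda>s. h s * F (x - t * g s)) = integral {x - t * g b..x - t * g a} F"
      (is ?eq)
proof -
  let ?\<xi> = "\<lambda>s. x - t * g s"
  have le: "g r \<le> g s" if "r \<le> s" for r s
    using g that by (simp add: strict_mono_less_eq)
  have cont: "continuous_on S g" for S
    using der by (meson DERIV_isCont continuous_at_imp_continuous_on)
  have img: "?\<xi> ` {a..b} = {?\<xi> b..?\<xi> a}"
  proof (intro equalityI subsetI)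
    fix y assume y: "y \<in> {?\<xi> b..?\<xi> a}"
    have "\<exists>s. a \<le> s \<and> s \<le> b \<and> g s = (x - y) / t"
      by (rule IVT'[of g a "(x - y) / t" b]) (use y t ab cont in \<open>auto simp: field_simps\<close>)
    then show "y \<in> ?\<xi> ` {a..b}" using t by (auto simp: field_simps image_iff)
  qed (use le t in auto)
  have sub: "(\<lambda>s. \<bar>- (t * h s)\<bar> * F (?\<xi> s)) absolutely_integrable_on {a..b} \<and>
     integral {a..b} (\<lambda>s. \<bar>- (t * h s)\<bar> * F (?\<xi> s)) = integral {?\<xi> b..?\<xi> a} F"
  proof (rule has_absolute_integral_change_of_variables_1'[where f = F and g = ?\<xi>, THEN iffD2])
    show "(?\<xi> has_real_derivative - (t * h s)) (at s within {a..b})" for s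
      using has_field_derivative_at_within[OF der] by (auto intro!: derivative_eq_intros)
    show "inj_on ?\<xi> {a..b}"
      using g t by (auto simp: inj_on_def strict_mono_eq)
  qed (use F img in auto)
  have "\<bar>- (t * h s)\<bar> * F (?\<xi> s) = t * (h s * F (?\<xi> s))" for s
    using h t by (simp add: abs_mult)
  then have sub': "(\<lambda>s. t * (h s * F (?\<xi> s))) absolutely_integrable_on {a..b}"
      "integral {a..b} (\<lambda>s. t * (h s * F (?\<xi> s))) = integral {?\<xi> b..?\<xi> a} F"
    using sub by (simp_all only:)
  show ?int
    using set_integrable_mult_right[of "1 / t", OF sub'(1)] t by simp
  show ?eq
    using sub'(2) by simp
qed

text \<open>If the nondecreasing \<open>g\<close> took equal values at \<open>a < b\<close>, it
  would be constant between them, and the zero set of \<open>h\<close> would contain an interval of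
  positive measure.\<close>

lemma strict_mono_of_deriv_null_zeros:
  fixes g h :: "real \<Rightarrow> real"
  assumes der: "\<And>s. (g has_real_derivative h s) (at s)"
    and h: "\<And>s. h s \<ge> 0" and null: "emeasure lebesgue {s. h s = 0} = 0"
    and cont: "continuous_on UNIV h"
  shows "strict_mono g"
proof (rule strict_monoI)
  fix a b :: real assume "a < b"
  have le: "g r \<le> g s" if "r \<le> s" for r s
    using that der h by (meson DERIV_nonneg_imp_nondecreasing)
  show "g a < g b"
  proof (rule ccontr)
    assume "\<not> g a < g b"
    then have const: "g s = g a" if "s \<in> {a<..<b}" for s
      using le[of a s] le[of s b] that by auto
    have zero: "h s = 0" if "s \<in> {a<..<b}" for s
    proof -
      have "(g has_real_derivative 0) (at s)"
        by (rule has_field_derivative_transform_within_open[of "\<lambda>_. g a" _ _ "{a<..<b}"])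
          (use const that in auto)
      then show ?thesis using der DERIV_unique by blast
    qed
    \<comment> \<open>Closedness makes the zero set measurable, as monotonicity of the measure
      requires.\<close>
    have "closed {s. h s = 0}"
      using cont by (intro closed_Collect_eq) auto
    then have "emeasure lebesgue {a<..<b} \<le> emeasure lebesgue {s. h s = 0}"
      using zero by (intro emeasure_mono) auto
    then show False using null \<open>a < b\<close> by simp
  qed
qed

section \<open>The energy difference and the tangent gap\<close>

text \<open>Split \<phi> - s as (\<phi> - c) - (s - c). The first part is handled by the
  substitution, which sends \<open>c\<close> to \<open>x\<^sub>0\<close> along the ray; the second
  has the explicit primitive \<open>g s * (s - c) - f s\<close>.\<close>

lemma energy_diff:
  assumes f: "\<And>s. (f has_real_derivative deriv f s) (at s)"
    and f': "\<And>s. (deriv f has_real_derivative deriv (deriv f) s) (at s)"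
    and cont: "continuous_on UNIV (deriv (deriv f))"
    and nonneg: "\<And>s. deriv (deriv f) s \<ge> 0" and mono: "strict_mono (deriv f)"
    and \<phi>: "\<And>a b. \<phi> absolutely_integrable_on {a..b}" and t: "t > 0"
  shows "E f \<phi> u (x\<^sub>0 + t * deriv f c) t - E f \<phi> c (x\<^sub>0 + t * deriv f c) t =
    - (LINT \<xi>=ereal x\<^sub>0..ereal (x\<^sub>0 + t * (deriv f c - deriv f u))|lebesgue. (\<phi> \<xi> - c))
    - t * (deriv f u * (u - c) - (f u - f c))"
proof -
  define g h x where "g = deriv f" and "h = deriv g" and "x = x\<^sub>0 + t * deriv f c"
  define G where "G = (\<lambda>s. h s * (\<phi> (x - t * g s) - s))"
  note der = f[folded g_def] f'[folded g_def, folded h_def]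
  have \<phi>c: "(\<lambda>\<xi>. \<phi> \<xi> - c) absolutely_integrable_on {a..b}" for a b
    by (intro set_integral_diff \<phi>) simp
  have poly: "(\<lambda>s. h s * (s - c)) absolutely_integrable_on {a..b}" for a b
    by (intro absolutely_integrable_continuous_real continuous_intros
        continuous_on_subset[OF cont[folded g_def, folded h_def]]) auto
  have G: "G = (\<lambda>s. h s * (\<phi> (x - t * g s) - c) - h s * (s - c))"
    by (simp add: G_def algebra_simps fun_eq_iff)
  note subst = integral_substitution_antimono[OF \<phi>c der(2) nonneg[folded g_def, folded h_def] mono[folded g_def] t]
  have G_int: "G absolutely_integrable_on {a..b}" for a b
  proof (cases "a \<le> b")
    case True
    then show ?thesis unfolding G by (intro set_integral_diff subst poly)
  qed simp
  have step: "t * integral {a..b} G = integral {x - t * g b..x - t * g a} (\<lambda>\<xi>. \<phi> \<xi> - c)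
      - t * ((g b * (b - c) - f b) - (g a * (a - c) - f a))" if "a \<le> b" for a b
  proof -
    have W: "integral {a..b} (\<lambda>s. h s * (s - c)) = (g b * (b - c) - f b) - (g a * (a - c) - f a)"
    proof (rule integral_unique, rule fundamental_theorem_of_calculus[OF that])
      fix s
      have "((\<lambda>s. g s * (s - c) - f s) has_real_derivative h s * (s - c)) (at s)"
        using der by (auto intro!: derivative_eq_intros)
      then show "((\<lambda>s. g s * (s - c) - f s) has_vector_derivative h s * (s - c)) (at s within {a..b})"
        by (simp add: has_real_derivative_iff_has_vector_derivative has_vector_derivative_at_within)
    qed
    have "integral {a..b} G = integral {a..b} (\<lambda>s. h s * (\<phi> (x - t * g s) - c))
        - integral {a..b} (\<lambda>s. h s * (s - c))"
      unfolding G by (intro Henstock_Kurzweil_Integration.integral_diff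
          set_lebesgue_integral_eq_integral(1) subst that poly)
    then show ?thesis
      unfolding subst(2)[OF that, of x, symmetric] by (simp only: W right_diff_distrib[of t])
  qed
  have E_eq: "E f \<phi> v x t = t * (LINT s=ereal 0..ereal v|lebesgue. G s)" for v
    by (simp add: E_def G_def g_def h_def)
  have x_c: "x - t * g c = x\<^sub>0" and x_u: "x - t * g u = x\<^sub>0 + t * (g c - g u)"
    by (simp_all add: x_def g_def algebra_simps)
  have le: "g r \<le> g s" if "r \<le> s" for r s
    using mono[folded g_def] that by (simp add: strict_mono_less_eq)
  have "E f \<phi> u x t - E f \<phi> c x t =
    - (LINT \<xi>=ereal x\<^sub>0..ereal (x\<^sub>0 + t * (g c - g u))|lebesgue. (\<phi> \<xi> - c))
    - t * (g u * (u - c) - (f u - f c))"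
  proof (cases "c \<le> u")
    case True
    have "E f \<phi> u x t - E f \<phi> c x t = t * integral {c..u} G"
      using interval_integral_lebesgue_diff[OF G_int True, of 0]
      by (simp add: E_eq flip: right_diff_distrib)
    \<comment> \<open>For \<open>c \<le> u\<close> the upper limit lies to the left of
      \<open>x\<^sub>0\<close>, so the orientation must be reversed.\<close>
    moreover have "(LINT \<xi>=ereal x\<^sub>0..ereal (x\<^sub>0 + t * (g c - g u))|lebesgue. (\<phi> \<xi> - c))
        = - integral {x\<^sub>0 + t * (g c - g u)..x\<^sub>0} (\<lambda>\<xi>. \<phi> \<xi> - c)"
      using le[OF True] t
      by (subst interval_integral_lebesgue_reverse)
        (simp add: interval_integral_lebesgue_eq_integral[OF \<phi>c] mult_le_0_iff)
    ultimately show ?thesis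
      using step[OF True] by (simp add: x_c x_u algebra_simps)
  next
    case False
    then have uc: "u \<le> c" by simp
    have "E f \<phi> u x t - E f \<phi> c x t = - (t * integral {u..c} G)"
      using interval_integral_lebesgue_diff[OF G_int uc, of 0]
      by (simp add: E_eq algebra_simps flip: right_diff_distrib)
    moreover have "(LINT \<xi>=ereal x\<^sub>0..ereal (x\<^sub>0 + t * (g c - g u))|lebesgue. (\<phi> \<xi> - c))
        = integral {x\<^sub>0..x\<^sub>0 + t * (g c - g u)} (\<lambda>\<xi>. \<phi> \<xi> - c)"
      using le[OF uc] t by (simp add: interval_integral_lebesgue_eq_integral[OF \<phi>c])
    ultimately show ?thesis
      using step[OF uc] by (simp add: x_c x_u algebra_simps)
  qed
  then show ?thesis by (simp add: g_def x_def)
qed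

text \<open>The quantity is the height at \<open>c\<close> of the graph of \<open>f\<close> above
  its tangent at \<open>u\<close>. A mean value point \<open>z\<close> strictly between
  \<open>c\<close> and \<open>u\<close> turns it into \<open>(u - c) * (g u - g z)\<close>;
  comparing \<open>g z\<close> with \<open>g u\<close> and with \<open>g c\<close> gives the two
  bounds.\<close>

lemma tangent_gap_bounds:
  fixes f g :: "real \<Rightarrow> real"
  assumes der: "\<And>s. (f has_real_derivative g s) (at s)" and mono: "strict_mono g" and "u \<noteq> c"
  shows "0 < g u * (u - c) - (f u - f c)"
    and "g u * (u - c) - (f u - f c) \<le> (u - c) * (g u - g c)"
proof -
  have "\<exists>z. f u - f c = g z * (u - c) \<and> (c < z \<and> z < u \<or> u < z \<and> z < c)"
  proof (cases "c < u")
    case True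
    then obtain z where "c < z" "z < u" "f u - f c = (u - c) * g z"
      using MVT2[of c u f g] der by auto
    then show ?thesis by (auto simp: mult.commute)
  next
    case False
    then have "u < c" using \<open>u \<noteq> c\<close> by simp
    then obtain z where "u < z" "z < c" "f c - f u = (c - u) * g z"
      using MVT2[of u c f g] der by auto
    then show ?thesis by (intro exI[of _ z]) (auto simp: algebra_simps)
  qed
  then obtain z where z: "f u - f c = g z * (u - c)" "c < z \<and> z < u \<or> u < z \<and> z < c"
    by blast
  have W: "g u * (u - c) - (f u - f c) = (u - c) * (g u - g z)"
    by (simp add: z(1) algebra_simps)
  show "0 < g u * (u - c) - (f u - f c)"
    unfolding W using z(2) mono by (auto simp: zero_less_mult_iff strict_mono_less)
  have "(u - c) * g c \<le> (u - c) * g z"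
    using z(2) mono by (auto simp: mult_le_cancel_left strict_mono_less_eq)
  then show "g u * (u - c) - (f u - f c) \<le> (u - c) * (g u - g c)"
    unfolding W by (simp add: right_diff_distrib)
qed

lemma C2_derivatives:
  assumes "C2 f"
  shows "(f has_real_derivative deriv f s) (at s)"
    and "(deriv f has_real_derivative deriv (deriv f) s) (at s)"
    and "continuous_on UNIV (deriv (deriv f))"
proof -
  have C1: "(k has_real_derivative deriv k s) (at s)" "continuous_on UNIV (deriv k)"
    if k: "k C1_differentiable_on UNIV" for k :: "real \<Rightarrow> real" and s
  proof -
    obtain D where D: "\<And>s. (k has_real_derivative D s) (at s)" "continuous_on UNIV D"
      using k by (auto simp: C1_differentiable_on_def has_real_derivative_iff_has_vector_derivative)
    \<comment> \<open>\<open>C1_differentiable_on\<close> only asserts that some continuous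
      derivative exists; uniqueness identifies it with \<open>deriv\<close>.\<close>
    have "deriv k = D"
      using D(1) by (intro ext DERIV_imp_deriv)
    then show "(k has_real_derivative deriv k s) (at s)" "continuous_on UNIV (deriv k)"
      using D by simp_all
  qed
  show "(f has_real_derivative deriv f s) (at s)"
    "(deriv f has_real_derivative deriv (deriv f) s) (at s)"
    "continuous_on UNIV (deriv (deriv f))"
    using assms C1 unfolding C2_def by blast+
qed

theorem proposition6p4:
  fixes f \<phi> :: "real \<Rightarrow> real" and x\<^sub>0 c :: real
  assumes "C2 f"
    and "\<And>s. deriv (deriv f) s \<ge> 0"
    and "emeasure lebesgue {s. deriv (deriv f) s = 0} = 0"
    and "L_infinity \<phi>"
  shows "divide_ray f \<phi> c x\<^sub>0 \<longleftrightarrow>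
    (\<forall>l::real. (LINT \<xi>=ereal x\<^sub>0..ereal (x\<^sub>0 + l)|lebesgue. (\<phi> \<xi> - c)) \<ge> 0)"
proof -
  define g where "g = deriv f"
  define P where "P = (\<lambda>l::real. LINT \<xi>=ereal x\<^sub>0..ereal (x\<^sub>0 + l)|lebesgue. (\<phi> \<xi> - c))"
  define W where "W = (\<lambda>u. g u * (u - c) - (f u - f c))"
  note der = C2_derivatives[OF assms(1)]
  have mono: "strict_mono g"
    unfolding g_def using der(2) assms(2,3) der(3) by (rule strict_mono_of_deriv_null_zeros)
  have E_diff: "E f \<phi> u (x\<^sub>0 + t * g c) t - E f \<phi> c (x\<^sub>0 + t * g c) t
      = - P (t * (g c - g u)) - t * W u" if "t > 0" for t u
    unfolding P_def W_def g_def
    by (rule energy_diff[OF der assms(2) mono[unfolded g_def] _ that])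
      (rule L_infinity_absolutely_integrable[OF assms(4)])
  have W: "0 < W u" "W u \<le> (u - c) * (g u - g c)" if "u \<noteq> c" for u
    using tangent_gap_bounds[OF der(1) mono[unfolded g_def] that] by (simp_all add: W_def g_def)
  have ray: "divide_ray f \<phi> c x\<^sub>0 \<longleftrightarrow> (\<forall>t>0. maximizers f \<phi> (x\<^sub>0 + t * g c) t = {c})"
    by (auto simp: divide_ray_def ray_def g_def)
  have "divide_ray f \<phi> c x\<^sub>0 \<longleftrightarrow> (\<forall>l. P l \<ge> 0)"
  proof
    assume div: "divide_ray f \<phi> c x\<^sub>0"
    show "\<forall>l. P l \<ge> 0"
    proof
      fix l
      \<comment> \<open>The positivity condition says that the time at which \<open>u\<close>
        corresponds to displacement \<open>l\<close> is admissible.\<close>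
      have bound: "- (\<bar>u - c\<bar> * \<bar>l\<bar>) \<le> P l" if "u \<noteq> c" and t: "l / (g c - g u) > 0" for u
      proof -
        define t where "t = l / (g c - g u)"
        have t0: "t > 0" using t by (simp add: t_def)
        have "g c \<noteq> g u" using t by auto
        then have l: "t * (g c - g u) = l" by (simp add: t_def)
        have "c \<in> maximizers f \<phi> (x\<^sub>0 + t * g c) t"
          using div t0 unfolding ray by blast
        then have "E f \<phi> u (x\<^sub>0 + t * g c) t \<le> E f \<phi> c (x\<^sub>0 + t * g c) t"
          by (simp add: maximizers_def)
        then have "- (t * W u) \<le> P l"
          using E_diff[OF t0, of u] by (simp add: l)
        moreover have "t * W u \<le> t * ((u - c) * (g u - g c))"
          using W(2)[OF \<open>u \<noteq> c\<close>] t0 by (intro mult_left_mono) auto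
        moreover have "t * ((u - c) * (g u - g c)) = - ((u - c) * l)"
          by (simp add: l[symmetric] algebra_simps)
        moreover have "- ((u - c) * l) \<le> \<bar>u - c\<bar> * \<bar>l\<bar>"
          by (metis abs_ge_minus_self abs_mult)
        ultimately show ?thesis by linarith
      qed
      show "P l \<ge> 0"
      \<comment> \<open>Displacement \<open>0\<close> corresponds to no positive time when
        \<open>u \<noteq> c\<close>; there the integral is over an empty interval.\<close>
      proof (cases "l = 0")
        case True
        then show ?thesis
          by (simp add: P_def interval_lebesgue_integral_def set_lebesgue_integral_def einterval_same)
      next
        case False
        have "- (e * \<bar>l\<bar>) \<le> P l" if "e > 0" for e
        proof -
          \<comment> \<open>Moving away from \<open>c\<close> against the sign of \<open>l\<close>
            gives \<open>g c - g u\<close> the sign of \<open>l\<close>, so the time is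
            positive.\<close>
          define u where "u = c - sgn l * e"
          have "u \<noteq> c" "\<bar>u - c\<bar> = e"
            using False that by (auto simp: u_def sgn_if)
          moreover have "l / (g c - g u) > 0"
            using False that mono
            by (auto simp: u_def sgn_if zero_less_divide_iff strict_mono_less)
          ultimately show ?thesis using bound[of u] by simp
        qed
        \<comment> \<open>Rescaling the distance by \<bar>l\<bar> makes the error exactly
          \<open>e\<close>.\<close>
        from this[of "_ / \<bar>l\<bar>"] have "0 \<le> P l + e" if "e > 0" for e
          using that False by (smt (verit) divide_pos_pos nonzero_eq_divide_eq)
        then show ?thesis by (rule field_le_epsilon)
      qed
    qed
  next
    assume P: "\<forall>l. P l \<ge> 0"
    \<comment> \<open>Strictness against every \<open>u \<noteq> c\<close> shows at once that
      \<open>c\<close> is a maximizer and that it is the only one.\<close>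
    have "E f \<phi> u (x\<^sub>0 + t * g c) t < E f \<phi> c (x\<^sub>0 + t * g c) t" if "t > 0" "u \<noteq> c" for t u
      using E_diff[OF that(1), of u] P[rule_format, of "t * (g c - g u)"]
        mult_pos_pos[OF that(1) W(1)[OF that(2)]] by linarith
    then show "divide_ray f \<phi> c x\<^sub>0"
      unfolding ray maximizers_def by (smt (verit, best) Collect_cong singleton_conv)
  qed
  then show ?thesis by (simp add: P_def)
qed

end
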